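(* For all $n\geq0$, \[ j_{2n}(213)=j_{2n}(312)=\frac{1}{2n+1}\binom{3n}{n}\quad\text{and}\quad j_{2n+1}(213)=j_{2n+1}(312)=\frac{1}{2n+1}\binom{3n+1}{n+1}. \]
   Context: A permutation of a finite set $S$ of positive integers is a word in which each element of $S$ appears exactly once; $\mathfrak{S}_n$ is the set of permutations of $\{1,\dots,n\}$. For a permutation $\pi$ and a letter $x$ of $\pi$, $\rho_\pi(x)$ is the maximal consecutive subword of $\pi$ consisting of the letters immediately to the right of $x$ that are all larger than $x$. $\pi$ is Jacobi if $|\rho_\pi(x)|$ is even for all letters $x$. The standardization of a word with distinct letters of length $m$ is the permutation in $\mathfrak{S}_m$ obtained by replacing its $i$th smallest letter by $i$. A permutation $\pi$ avoids $\sigma$ if no (not necessarily consecutive) subword of $\pi$ has standardization $\sigma$. For a set $\Pi$ of patterns, $j_n(\Pi)$ is the number of Jacobi permutations in $\mathfrak{S}_n$ avoiding every pattern in $\Pi$; $j_n(\sigma)=j_n(\{\sigma\})$. *)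

theory Defs
  imports Complex_Main "HOL-Library.Sublist" "HOL-Combinatorics.Multiset_Permutations"
begin

(* Words are lists of naturals; the permutations of a finite set S are
   permutations_of_set S = {xs. set xs = S \<and> distinct xs}. *)

definition rho :: "nat list \<Rightarrow> nat \<Rightarrow> nat list" where
  "rho \<pi> x = takeWhile (\<lambda>y. x < y) (tl (dropWhile (\<lambda>y. y \<noteq> x) \<pi>))"

definition jacobi :: "nat list \<Rightarrow> bool" where
  "jacobi \<pi> \<longleftrightarrow> (\<forall>x\<in>set \<pi>. even (length (rho \<pi> x)))"

(* For distinct letters, x is the i-th smallest letter of w iff exactly i letters of w are \<le> x. *)
definition standardization :: "nat list \<Rightarrow> nat list" where
  "standardization w = map (\<lambda>x. card {y \<in> set w. y \<le> x}) w"

definition avoids :: "nat list \<Rightarrow> nat list \<Rightarrow> bool" where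
  "avoids \<pi> \<sigma> \<longleftrightarrow> \<not> (\<exists>w. subseq w \<pi> \<and> standardization w = \<sigma>)"

definition jacobi_avoiders :: "nat \<Rightarrow> nat list set \<Rightarrow> nat list set" where
  "jacobi_avoiders n P =
     {\<pi> \<in> permutations_of_set {1..n}. jacobi \<pi> \<and> (\<forall>\<sigma>\<in>P. avoids \<pi> \<sigma>)}"

definition j_num :: "nat \<Rightarrow> nat list set \<Rightarrow> nat" where
  "j_num n P = card (jacobi_avoiders n P)"

end

theory Submission
  imports Defs "HOL-Computational_Algebra.Formal_Power_Series"
begin

text \<open>
  Write a permutation as \<open>L m R\<close> with \<open>m\<close> its smallest letter. It is Jacobi iff \<open>L\<close> and \<open>R\<close> are
  Jacobi and \<open>|R|\<close> is even, and it avoids 213 (312) iff \<open>L\<close> and \<open>R\<close> do and every letter of \<open>L\<close> is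
  larger (smaller) than every letter of \<open>R\<close>. In both cases the letter sets of \<open>L\<close> and \<open>R\<close> are
  intervals determined by \<open>|R|\<close>, so both families satisfy the same recurrence. For the generating
  functions \<open>A\<close> and \<open>B\<close> of the even and odd lengths it says \<open>B = A\<^sup>2\<close> and \<open>A = 1 + X A B\<close>. From
  \<open>A\<^sup>r\<^sup>+\<^sup>1 = A\<^sup>r + X A\<^sup>r\<^sup>+\<^sup>3\<close> the coefficients of all powers of \<open>A\<close> follow by induction, without Lagrange
  inversion.
\<close>

section \<open>Decomposition at the smallest letter\<close>

text \<open>The patterns 213 and 312 are the case \<open>T = (<)\<close> and the case \<open>T = (>)\<close>.\<close>

definition valley_free :: "(nat \<Rightarrow> nat \<Rightarrow> bool) \<Rightarrow> nat list \<Rightarrow> bool" where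
  "valley_free T \<pi> \<longleftrightarrow> (\<forall>x y z. subseq [x, y, z] \<pi> \<longrightarrow> y < x \<longrightarrow> y < z \<longrightarrow> \<not> T x z)"

lemma standardization_triple:
  assumes "distinct [x, y, z]"
  shows "standardization [x, y, z] = [2, 1, 3] \<longleftrightarrow> y < x \<and> y < z \<and> x < z"
    and "standardization [x, y, z] = [3, 1, 2] \<longleftrightarrow> y < x \<and> y < z \<and> x > z"
proof -
  have card_le: "card {u \<in> set [x, y, z]. u \<le> t}
      = of_bool (x \<le> t) + of_bool (y \<le> t) + of_bool (z \<le> t)" for t
  proof -
    have "{u \<in> set [x, y, z]. u \<le> t} = set (filter (\<lambda>u. u \<le> t) [x, y, z])"
      by auto
    also have "card \<dots> = length (filter (\<lambda>u. u \<le> t) [x, y, z])"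
      using assms by (intro distinct_card distinct_filter)
    finally show ?thesis
      by simp
  qed
  have std: "standardization [x, y, z] =
      map (\<lambda>t. of_bool (x \<le> t) + of_bool (y \<le> t) + of_bool (z \<le> t)) [x, y, z]"
    unfolding standardization_def card_le ..
  show "standardization [x, y, z] = [2, 1, 3] \<longleftrightarrow> y < x \<and> y < z \<and> x < z"
    and "standardization [x, y, z] = [3, 1, 2] \<longleftrightarrow> y < x \<and> y < z \<and> x > z"
    using assms unfolding std by (auto simp: of_bool_def split: if_splits)
qed

text \<open>Standardization preserves length, so only three-letter subwords can realize
  \<open>\<sigma>\<close>. Its middle letter being smallest, \<open>T\<close> only has to record how
  the outer two compare.\<close>

lemma avoids_eq_valley_free:
  assumes "distinct \<pi>" and "length \<sigma> = 3"
    and std: "\<And>x y z. distinct [x, y, z] \<Longrightarrow>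
      standardization [x, y, z] = \<sigma> \<longleftrightarrow> y < x \<and> y < z \<and> T x z"
  shows "avoids \<pi> \<sigma> \<longleftrightarrow> valley_free T \<pi>"
proof -
  have triple: "\<exists>x y z. w = [x, y, z]" if "standardization w = \<sigma>" for w
  proof -
    have "length w = 3"
      using that assms(2) by (auto simp: standardization_def)
    then show ?thesis
      by (auto simp: numeral_3_eq_3 length_Suc_conv)
  qed
  have "distinct w" if "subseq w \<pi>" for w
    using that assms(1) by (auto simp: subseq_conv_nths)
  then show ?thesis
    unfolding avoids_def valley_free_def using triple std by metis
qed

text \<open>The letter \<open>m\<close> stops every run that starts in \<open>L\<close>, its own run
  is all of \<open>R\<close>, and runs in \<open>R\<close> never look to the left.\<close>

lemma jacobi_append_min:
  assumes dist: "distinct (L @ m # R)" and min: "\<forall>x\<in>set L \<union> set R. m < x"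
  shows "jacobi (L @ m # R) \<longleftrightarrow> jacobi L \<and> jacobi R \<and> even (length R)"
proof -
  have left: "rho (L @ m # R) x = rho L x" if "x \<in> set L" for x
  proof -
    have "dropWhile (\<lambda>y. y \<noteq> x) L \<noteq> []"
      using that by (auto simp: dropWhile_eq_Nil_conv)
    moreover have "m < x"
      using that min by blast
    ultimately show ?thesis
      unfolding rho_def using that
      by (simp add: dropWhile_append1[of x] takeWhile_tail)
  qed
  have mid: "rho (L @ m # R) m = R"
    unfolding rho_def using dist min
    by (subst dropWhile_append2) (auto simp: takeWhile_eq_all_conv)
  have right: "rho (L @ m # R) x = rho R x" if "x \<in> set R" for x
    unfolding rho_def using dist that
    by (subst dropWhile_append2) auto
  show ?thesis
    unfolding jacobi_def by (simp add: left mid right ball_Un) blast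
qed

text \<open>The condition linking \<open>L\<close> and \<open>R\<close> comes from the valleys
  \<open>x m z\<close>, which exist for every \<open>x\<close> in \<open>L\<close> and
  \<open>z\<close> in \<open>R\<close>.\<close>

lemma valley_free_append_min:
  assumes min: "\<forall>x\<in>set L \<union> set R. m < x"
  shows "valley_free T (L @ m # R) \<longleftrightarrow>
    valley_free T L \<and> valley_free T R \<and> (\<forall>x\<in>set L. \<forall>z\<in>set R. \<not> T x z)"
proof safe
  assume free: "valley_free T (L @ m # R)"
  show "valley_free T L"
    using free unfolding valley_free_def by (meson subseq_rev_drop_many)
  show "valley_free T R"
    using free unfolding valley_free_def by (meson subseq_drop_many list_emb_Cons)
  fix x z assume "x \<in> set L" "z \<in> set R" "T x z"
  have "subseq ([x] @ [m] @ [z]) (L @ [m] @ R)"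
    using \<open>x \<in> set L\<close> \<open>z \<in> set R\<close> by (intro list_emb_append_mono) (auto simp: subseq_singleton_left)
  then show False
    using free min \<open>x \<in> set L\<close> \<open>z \<in> set R\<close> \<open>T x z\<close> unfolding valley_free_def by auto
next
  assume L: "valley_free T L" and R: "valley_free T R"
    and LR: "\<forall>x\<in>set L. \<forall>z\<in>set R. \<not> T x z"
  show "valley_free T (L @ m # R)"
    unfolding valley_free_def
  proof safe
    fix x y z assume sub: "subseq [x, y, z] (L @ m # R)" and "y < x" "y < z" "T x z"
    from sub obtain us vs where split: "[x, y, z] = us @ vs" "subseq us L" "subseq vs (m # R)"
      by (auto simp: subseq_append_iff)
    have us: "set us \<subseteq> set L" and vs: "set vs \<subseteq> insert m (set R)"
      using split(2,3) by (auto simp: subseq_conv_nths dest: in_set_nthsD)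
    have "vs = [] \<or> us = [] \<or> (x \<in> set us \<and> z \<in> set vs)"
      using split(1) by (cases us; cases vs rule: rev_cases) auto
    then consider "vs = []" | "us = []" | "x \<in> set us" "z \<in> set vs"
      by blast
    then show False
    proof cases
      case 1
      then show False
        using split L \<open>y < x\<close> \<open>y < z\<close> \<open>T x z\<close> unfolding valley_free_def by auto
    next
      case 2
      then have eq: "vs = [x, y, z]"
        using split(1) by simp
      then have "y = m \<or> y \<in> set R"
        using vs by auto
      \<comment> \<open>The top of a descent cannot be the minimum, so the triple does not start at
        \<open>m\<close> and lies within \<open>R\<close>.\<close>
      then have "x \<noteq> m"
        using min \<open>y < x\<close> by (metis UnCI less_asym less_irrefl)
      then have "subseq [x, y, z] R"
        using split(3) eq by (auto simp: subseq_Cons2_iff split: if_splits)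
      then show False
        using R \<open>y < x\<close> \<open>y < z\<close> \<open>T x z\<close> unfolding valley_free_def by auto
    next
      case 3
      have "z \<noteq> m"
      proof
        assume "z = m"
        moreover have "y \<in> set L \<union> insert m (set R)"
          using us vs split(1) by (metis Un_iff list.set_intros set_append subsetD)
        ultimately show False
          using min \<open>y < z\<close> by (metis Un_iff insert_iff less_asym less_irrefl)
      qed
      then show False
        using 3 us vs LR \<open>T x z\<close> by blast
    qed
  qed
qed

section \<open>The recurrence\<close>

text \<open>Here \<open>b\<close> is the length of the word to the right of the smallest letter; its
  parity is the Jacobi condition at that letter.\<close>

fun jacobi_count :: "nat \<Rightarrow> nat" where
  "jacobi_count 0 = 1"
| "jacobi_count (Suc N) = (\<Sum>b | b \<le> N \<and> even b. jacobi_count (N - b) * jacobi_count b)"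

text \<open>A general letter set \<open>S\<close> lets the left and right words be counted as they
  are, without standardizing them.\<close>

definition valley_free_jacobi :: "(nat \<Rightarrow> nat \<Rightarrow> bool) \<Rightarrow> nat set \<Rightarrow> nat list set" where
  "valley_free_jacobi T S = {\<pi> \<in> permutations_of_set S. jacobi \<pi> \<and> valley_free T \<pi>}"

lemma finite_valley_free_jacobi: "finite (valley_free_jacobi T S)"
  by (simp add: valley_free_jacobi_def)

text \<open>
  The hypothesis states that the letter sets of the words to the left and to the right of the
  smallest letter \<open>a\<close> are intervals starting at \<open>l a N b\<close> and \<open>r a N b\<close>, where \<open>b\<close> is the length of
  the right word.
\<close>

lemma card_valley_free_jacobi:
  fixes l r :: "nat \<Rightarrow> nat \<Rightarrow> nat \<Rightarrow> nat"
  assumes split: "\<And>a N b X Y. b \<le> N \<Longrightarrow>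
    (X \<union> Y = {Suc a..<Suc a + N} \<and> X \<inter> Y = {} \<and> card Y = b \<and> (\<forall>x\<in>X. \<forall>y\<in>Y. \<not> T x y)) \<longleftrightarrow>
    (X = {l a N b..<l a N b + (N - b)} \<and> Y = {r a N b..<r a N b + b})"
  shows "card (valley_free_jacobi T {a..<a + N}) = jacobi_count N"
\<comment> \<open>The two smaller words live on intervals with other starting points, hence the
  arbitrary \<open>a\<close>.\<close>
proof (induction N arbitrary: a rule: less_induct)
  case (less N)
  show ?case
  proof (cases N)
    case 0
    have "valley_free_jacobi T {} = {[]}"
      by (auto simp: valley_free_jacobi_def jacobi_def valley_free_def)
    then show ?thesis
      using 0 by simp
  next
    case (Suc M)
    let ?J = "valley_free_jacobi T"
    let ?A = "\<lambda>b. ?J {l a M b..<l a M b + (M - b)}" and ?B = "\<lambda>b. ?J {r a M b..<r a M b + b}"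
    let ?D = "SIGMA b:{b. b \<le> M \<and> even b}. ?A b \<times> ?B b"
    let ?f = "\<lambda>(b::nat, L, R). L @ a # R"
    have interval: "{a..<a + N} = insert a {Suc a..<Suc a + M}"
      using Suc by auto
    have "?J {a..<a + N} = ?f ` ?D"
    proof (intro equalityI subsetI)
      fix \<pi> assume "\<pi> \<in> ?J {a..<a + N}"
      then have \<pi>: "set \<pi> = insert a {Suc a..<Suc a + M}" "distinct \<pi>" "jacobi \<pi>" "valley_free T \<pi>"
        by (auto simp: valley_free_jacobi_def permutations_of_set_def interval)
      then obtain L R where LR: "\<pi> = L @ a # R"
        by (metis insertI1 split_list)
      have un: "set L \<union> set R = {Suc a..<Suc a + M}" and disj: "set L \<inter> set R = {}"
        and dist: "distinct L" "distinct R"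
        using \<pi>(1,2) unfolding LR by (auto simp: insert_eq_iff)
      have min: "\<forall>x\<in>set L \<union> set R. a < x"
        using un by auto
      have jac: "jacobi L" "jacobi R" "even (length R)"
        using jacobi_append_min[of L a R] \<pi> min unfolding LR by auto
      have free: "valley_free T L" "valley_free T R" "\<forall>x\<in>set L. \<forall>z\<in>set R. \<not> T x z"
        using valley_free_append_min[of L R a T] \<pi> min unfolding LR by auto
      have card: "card (set R) = length R"
        using dist by (simp add: distinct_card)
      have le: "length R \<le> M"
        using card_mono[of "{Suc a..<Suc a + M}" "set R"] un card by auto
      have "set L = {l a M (length R)..<l a M (length R) + (M - length R)} \<and>
          set R = {r a M (length R)..<r a M (length R) + length R}"
        using split[OF le, of "set L" "set R" a] un disj card free(3) by blast
      then have "(length R, L, R) \<in> ?D"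
        using le jac free dist by (auto simp: valley_free_jacobi_def permutations_of_set_def)
      then show "\<pi> \<in> ?f ` ?D"
        unfolding LR by (rule rev_image_eqI) simp
    next
      fix \<pi> assume "\<pi> \<in> ?f ` ?D"
      then obtain b L R where b: "b \<le> M" "even b" and L: "L \<in> ?A b" and R: "R \<in> ?B b"
        and LR: "\<pi> = L @ a # R"
        by auto
      have sets: "set L = {l a M b..<l a M b + (M - b)}" "set R = {r a M b..<r a M b + b}"
        and dist: "distinct L" "distinct R"
        using L R by (auto simp: valley_free_jacobi_def permutations_of_set_def)
      have un: "set L \<union> set R = {Suc a..<Suc a + M}" "set L \<inter> set R = {}" "card (set R) = b"
        and T: "\<forall>x\<in>set L. \<forall>y\<in>set R. \<not> T x y"
        using split[OF b(1), of "set L" "set R" a] sets by blast+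
      have min: "\<forall>x\<in>set L \<union> set R. a < x"
        using un by auto
      have dist': "distinct (L @ a # R)"
        using dist un(2) min by auto
      have "even (length R)"
        using un(3) b(2) dist by (simp add: distinct_card)
      then show "\<pi> \<in> ?J {a..<a + N}"
        using L R dist' un(1) jacobi_append_min[OF dist' min] valley_free_append_min[OF min, of T] T
        unfolding LR interval by (auto simp: valley_free_jacobi_def permutations_of_set_def)
    qed
    moreover have "inj_on ?f ?D"
    proof (rule inj_onI)
      fix p q assume "p \<in> ?D" "q \<in> ?D" "?f p = ?f q"
      moreover obtain b L R b' L' R' where pq: "p = (b, L, R)" "q = (b', L', R')"
        by (metis prod.exhaust)
      ultimately have *: "L \<in> ?A b" "R \<in> ?B b" "b \<le> M" "L' \<in> ?A b'" "R' \<in> ?B b'" "b' \<le> M"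
        and eq: "L @ a # R = L' @ a # R'"
        by auto
      \<comment> \<open>Since \<open>a\<close> does not occur in the left word, its first occurrence
        marks the cut; \<open>b\<close> is then recovered as the length of the right word.\<close>
      have notin: "a \<notin> set K" if "K \<in> ?A c" "c \<le> M" for K c
      proof -
        have "set K \<subseteq> {Suc a..<Suc a + M}"
          using split[OF that(2), of "set K" "{r a M c..<r a M c + c}" a] that(1)
          unfolding valley_free_jacobi_def permutations_of_set_def by blast
        then show ?thesis
          by auto
      qed
      have len: "length K = c" if "K \<in> ?B c" for K c
        using that by (auto simp: valley_free_jacobi_def permutations_of_set_def dest: distinct_card)
      have "a \<notin> set L" "a \<notin> set L'"
        using notin * by blast+
      then have "L = L' \<and> R = R'"
        using eq by (auto simp: append_eq_append_conv2 append_eq_Cons_conv Cons_eq_append_conv)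
      then show "p = q"
        using len * unfolding pq by auto
    qed
    ultimately have "card (?J {a..<a + N}) = card ?D"
      by (simp add: card_image)
    also have "\<dots> = (\<Sum>b | b \<le> M \<and> even b. card (?A b) * card (?B b))"
      by (subst card_SigmaI) (auto simp: finite_valley_free_jacobi card_cartesian_product)
    also have "\<dots> = (\<Sum>b | b \<le> M \<and> even b. jacobi_count (M - b) * jacobi_count b)"
      using Suc by (intro sum.cong refl arg_cong2[where f = "(*)"] less.IH) auto
    finally show ?thesis
      using Suc by simp
  qed
qed

text \<open>As \<open>Y\<close> lies below \<open>X\<close> and together they fill the interval,
  \<open>Y\<close> is an initial segment, hence determined by its size.\<close>

lemma interval_split_iff:
  fixes X Y :: "nat set"
  assumes "b \<le> N"
  shows "(X \<union> Y = {a..<a + N} \<and> X \<inter> Y = {} \<and> card Y = b \<and> (\<forall>x\<in>X. \<forall>y\<in>Y. y \<le> x)) \<longleftrightarrow>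
    (X = {a + b..<a + N} \<and> Y = {a..<a + b})"
proof
  assume *: "X \<union> Y = {a..<a + N} \<and> X \<inter> Y = {} \<and> card Y = b \<and> (\<forall>x\<in>X. \<forall>y\<in>Y. y \<le> x)"
  then have fin: "finite Y"
    by (metis finite_Un finite_atLeastLessThan)
  have "Y = {a..<a + b}"
  proof (cases "Y = {}")
    case True
    then show ?thesis
      using * by auto
  next
    case False
    \<comment> \<open>A letter of \<open>X\<close> that is at most \<open>Max Y\<close> would equal
      \<open>Max Y\<close>, against disjointness; so \<open>Y\<close> has no gaps.\<close>
    have "Y = {a..Max Y}"
    proof (intro equalityI subsetI)
      fix y assume "y \<in> Y"
      then show "y \<in> {a..Max Y}"
        using * fin by auto
    next
      fix y assume y: "y \<in> {a..Max Y}"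
      have Max: "Max Y \<in> Y"
        using fin False by simp
      then have "Max Y \<in> {a..<a + N}"
        using * by blast
      then have "y \<in> X \<union> Y"
        using * y by auto
      moreover have "y \<notin> X"
        using * y Max by (metis atLeastAtMost_iff disjoint_iff le_antisym)
      ultimately show "y \<in> Y"
        by blast
    qed
    moreover from this have "b = Suc (Max Y) - a"
      using * by (metis card_atLeastAtMost)
    moreover have "a \<le> Max Y"
      using calculation False by (metis atLeastatMost_empty_iff)
    ultimately show ?thesis
      by (simp add: atLeastLessThanSuc_atLeastAtMost)
  qed
  moreover have "X = {a..<a + N} - Y"
    using * by blast
  ultimately show "X = {a + b..<a + N} \<and> Y = {a..<a + b}"
    by auto
next
  assume "X = {a + b..<a + N} \<and> Y = {a..<a + b}"
  then show "X \<union> Y = {a..<a + N} \<and> X \<inter> Y = {} \<and> card Y = b \<and> (\<forall>x\<in>X. \<forall>y\<in>Y. y \<le> x)"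
    using assms by auto
qed

lemma card_valley_free_jacobi_less: "card (valley_free_jacobi (<) {a..<a + N}) = jacobi_count N"
proof (rule card_valley_free_jacobi)
  fix a N b :: nat and X Y assume "b \<le> N"
  then show "(X \<union> Y = {Suc a..<Suc a + N} \<and> X \<inter> Y = {} \<and> card Y = b \<and> (\<forall>x\<in>X. \<forall>y\<in>Y. \<not> x < y)) \<longleftrightarrow>
    (X = {Suc a + b..<Suc a + b + (N - b)} \<and> Y = {Suc a..<Suc a + b})"
    using interval_split_iff[of b N X Y "Suc a"] by (simp add: not_less)
qed

text \<open>Now the left word takes the smallest letters, so \<open>interval_split_iff\<close> is
  used with \<open>X\<close> and \<open>Y\<close> exchanged and size \<open>N - b\<close>.\<close>

lemma card_valley_free_jacobi_greater: "card (valley_free_jacobi (>) {a..<a + N}) = jacobi_count N"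
proof (rule card_valley_free_jacobi)
  fix a N b :: nat and X Y :: "nat set" assume b: "b \<le> N"
  have card: "card X = N - b \<longleftrightarrow> card Y = b" if "X \<union> Y = {Suc a..<Suc a + N}" "X \<inter> Y = {}"
  proof -
    have "finite X" "finite Y"
      using that(1) by (metis finite_Un finite_atLeastLessThan)+
    then have "card X + card Y = N"
      using card_Un_disjoint[of X Y] that by simp
    then show ?thesis
      using b by auto
  qed
  have "(X \<union> Y = {Suc a..<Suc a + N} \<and> X \<inter> Y = {} \<and> card Y = b \<and> (\<forall>x\<in>X. \<forall>y\<in>Y. \<not> x > y)) \<longleftrightarrow>
    (Y \<union> X = {Suc a..<Suc a + N} \<and> Y \<inter> X = {} \<and> card X = N - b \<and> (\<forall>y\<in>Y. \<forall>x\<in>X. x \<le> y))"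
    unfolding not_less Un_commute[of Y X] Int_commute[of Y X] using card by meson
  also have "\<dots> \<longleftrightarrow> (Y = {Suc a + (N - b)..<Suc a + N} \<and> X = {Suc a..<Suc a + (N - b)})"
    by (rule interval_split_iff) simp
  also have "\<dots> \<longleftrightarrow> (X = {Suc a..<Suc a + (N - b)} \<and> Y = {Suc a + (N - b)..<Suc a + (N - b) + b})"
    using b by auto
  finally show "(X \<union> Y = {Suc a..<Suc a + N} \<and> X \<inter> Y = {} \<and> card Y = b \<and> (\<forall>x\<in>X. \<forall>y\<in>Y. \<not> x > y)) \<longleftrightarrow>
    (X = {Suc a..<Suc a + (N - b)} \<and> Y = {Suc a + (N - b)..<Suc a + (N - b) + b})"
    .
qed

lemma j_num_eq_jacobi_count:
  "j_num n {[2, 1, 3]} = jacobi_count n" "j_num n {[3, 1, 2]} = jacobi_count n"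
proof -
  have "jacobi_avoiders n {\<sigma>} = valley_free_jacobi T {1..<1 + n}"
    if "length \<sigma> = 3" "\<And>x y z. distinct [x, y, z] \<Longrightarrow>
      standardization [x, y, z] = \<sigma> \<longleftrightarrow> y < x \<and> y < z \<and> T x z" for \<sigma> T
    using avoids_eq_valley_free[OF _ that]
    by (auto simp: jacobi_avoiders_def valley_free_jacobi_def permutations_of_set_def
        atLeastLessThanSuc_atLeastAtMost)
  then show "j_num n {[2, 1, 3]} = jacobi_count n" "j_num n {[3, 1, 2]} = jacobi_count n"
    unfolding j_num_def
    using standardization_triple card_valley_free_jacobi_less[of 1 n]
      card_valley_free_jacobi_greater[of 1 n] by simp_all
qed

section \<open>Solving the recurrence\<close>

lemma sum_even_atMost:
  fixes g :: "nat \<Rightarrow> nat"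
  shows "(\<Sum>b | b \<le> N \<and> even b. g b) = (\<Sum>k\<le>N div 2. g (2 * k))"
  by (rule sum.reindex_bij_witness[of _ "\<lambda>k. 2 * k" "\<lambda>b. b div 2"]) auto

text \<open>Beside the minimum \<open>2 * n\<close> letters remain, so an even right word forces an
  even left word: this is \<open>B = A^2\<close> in coefficients.\<close>

lemma jacobi_count_odd:
  "jacobi_count (2 * n + 1) = (\<Sum>k\<le>n. jacobi_count (2 * k) * jacobi_count (2 * (n - k)))"
  by (simp add: sum_even_atMost right_diff_distrib' mult.commute[of "jacobi_count (2 * (n - _))"])
    (simp add: diff_mult_distrib2 mult.commute)

text \<open>With \<open>2 * n + 1\<close> letters remaining, the left word is odd; this is
  \<open>A = 1 + X A B\<close> beyond the constant term.\<close>

lemma jacobi_count_even: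
  "jacobi_count (2 * n + 2) = (\<Sum>k\<le>n. jacobi_count (2 * k) * jacobi_count (2 * (n - k) + 1))"
proof -
  have "jacobi_count (2 * n + 2) = jacobi_count (Suc (2 * n + 1))"
    by simp
  also have "\<dots> = (\<Sum>k\<le>n. jacobi_count (2 * n + 1 - 2 * k) * jacobi_count (2 * k))"
    by (subst jacobi_count.simps(2), subst sum_even_atMost) simp
  also have "\<dots> = (\<Sum>k\<le>n. jacobi_count (2 * k) * jacobi_count (2 * (n - k) + 1))"
  proof (rule sum.cong)
    fix k assume "k \<in> {..n}"
    then have "2 * n + 1 - 2 * k = 2 * (n - k) + 1"
      by auto
    then show "jacobi_count (2 * n + 1 - 2 * k) * jacobi_count (2 * k)
        = jacobi_count (2 * k) * jacobi_count (2 * (n - k) + 1)"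
      by (simp only: mult.commute)
  qed simp
  finally show ?thesis .
qed

text \<open>Read row by row in \<open>n\<close>, the functional equation determines all powers of \<open>A\<close>.\<close>

lemma fps_nth_power_ternary:
  fixes A :: "real fps"
  assumes "A = 1 + fps_X * A ^ 3"
  shows "fps_nth (A ^ Suc r) n = (r + 1) * fact (3 * n + r) / (fact n * fact (2 * n + r + 1))"
proof (induction n arbitrary: r)
  case 0
  have "fps_nth A 0 = 1"
    by (subst assms) simp
  moreover have "(real r + 1) * fact r = fact (Suc r)"
    by (simp add: algebra_simps)
  ultimately show ?case
    by (simp add: fps_power_zeroth del: power_Suc fact_Suc)
next
  case (Suc n)
  note IH = Suc.IH
  have step: "fps_nth (A ^ Suc r) (Suc n) = fps_nth (A ^ r) (Suc n) + fps_nth (A ^ Suc (r + 2)) n" for r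
  proof -
    have "A ^ Suc r = A ^ r * (1 + fps_X * A ^ 3)"
      using arg_cong[OF assms, of "\<lambda>B. A ^ r * B"] by (simp only: power_Suc2)
    also have "\<dots> = A ^ r + fps_X * A ^ Suc (r + 2)"
      by (simp add: algebra_simps power_add eval_nat_numeral)
    finally show ?thesis
      by (simp del: power_Suc)
  qed
  show ?case
  \<comment> \<open>Within row \<open>Suc n\<close>, \<open>step\<close> lowers the exponent by one
    at the cost of a coefficient from row \<open>n\<close>, known for every exponent.\<close>
  proof (induction r)
    \<comment> \<open>The constant series \<open>A ^ 0\<close> contributes nothing in row
      \<open>Suc n\<close>, leaving only the coefficient of \<open>A ^ 3\<close> in row
      \<open>n\<close>.\<close>
    case 0
    define g where "g = (fact (2 * Suc n + 0 + 1) :: real)"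
    have facts: "fact (3 * Suc n + 0) = 3 * (real n + 1) * fact (3 * n + 2)"
      "fact (Suc n) = (real n + 1) * fact n"
      by (simp_all add: eval_nat_numeral algebra_simps)
    have "fps_nth (A ^ Suc 0) (Suc n) = 3 * fact (3 * n + 2) / (fact n * g)"
      unfolding step IH g_def by (simp add: eval_nat_numeral algebra_simps)
    also have "\<dots> = 3 * (real n + 1) * fact (3 * n + 2) / ((real n + 1) * fact n * g)"
      using mult_divide_mult_cancel_left[of "real n + 1" "3 * fact (3 * n + 2)" "fact n * g"]
      by (simp only: ac_simps)
    finally show ?case
      unfolding facts g_def[symmetric] by (simp del: power_Suc fact_Suc)
  next
    case (Suc r)
    define p q f where "p = (fact (3 * n + r + 3) :: real)" and "q = (fact (2 * n + r + 3) :: real)"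
      and "f = (fact n :: real)"
    have pos: "p > 0" "q > 0" "f > 0"
      by (simp_all add: p_def q_def f_def)
    have facts: "fact (3 * Suc n + r) = p" "fact (2 * Suc n + r + 1) = q"
      "fact (Suc n) = (real n + 1) * f" "fact (3 * n + (Suc r + 2)) = p"
      "fact (2 * n + (Suc r + 2) + 1) = (2 * real n + real r + 4) * q"
      "fact (3 * Suc n + Suc r) = (3 * real n + real r + 4) * p"
      "fact (2 * Suc n + Suc r + 1) = (2 * real n + real r + 4) * q"
      unfolding p_def q_def f_def by (simp_all add: eval_nat_numeral algebra_simps)
    have nz: "real n + 1 \<noteq> 0" "2 * real n + real r + 4 \<noteq> 0"
      by linarith+
    have "fps_nth (A ^ Suc (Suc r)) (Suc n) = (real r + 1) * p / ((real n + 1) * f * q)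
        + (real r + 4) * p / (f * ((2 * real n + real r + 4) * q))"
      unfolding step[of "Suc r"] Suc.IH IH facts f_def[symmetric] by (simp add: add.commute)
    \<comment> \<open>Over a common denominator this is
      \<open>(r+1)(2n+r+4) + (r+4)(n+1) = (r+2)(3n+r+4)\<close>.\<close>
    also have "\<dots> = (real r + 2) * ((3 * real n + real r + 4) * p)
        / ((real n + 1) * f * ((2 * real n + real r + 4) * q))"
      using pos nz by (simp add: divide_simps) (simp add: algebra_simps)
    finally show ?case
      unfolding facts by (simp add: algebra_simps)
  qed
qed

text \<open>Eliminating \<open>B\<close> leaves \<open>A = 1 + X A^3\<close>; even lengths are read
  off from \<open>A\<close>, odd lengths from \<open>A^2\<close>.\<close>

lemma jacobi_count_closed_forms:
  "real (jacobi_count (2 * n)) = fact (3 * n) / (fact n * fact (2 * n + 1))"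
  "real (jacobi_count (2 * n + 1)) = 2 * fact (3 * n + 1) / (fact n * fact (2 * n + 2))"
proof -
  define A where "A = Abs_fps (\<lambda>n. real (jacobi_count (2 * n)))"
  have sq: "fps_nth (A ^ 2) n = real (jacobi_count (2 * n + 1))" for n
    unfolding jacobi_count_odd by (simp add: A_def power2_eq_square fps_mult_nth atMost_atLeast0)
  have "A = 1 + fps_X * A ^ 3"
  proof (rule fps_ext)
    fix n
    show "fps_nth A n = fps_nth (1 + fps_X * A ^ 3) n"
    proof (cases n)
      case 0
      then show ?thesis
        by (simp add: A_def)
    next
      case (Suc m)
      have "fps_nth (A ^ 3) m = fps_nth (A * A ^ 2) m"
        by (simp add: eval_nat_numeral)
      also have "\<dots> = real (jacobi_count (2 * m + 2))"
        unfolding jacobi_count_even fps_mult_nth sq by (simp add: A_def atMost_atLeast0)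
      finally show ?thesis
        using Suc by (simp add: A_def)
    qed
  qed
  from fps_nth_power_ternary[OF this, of 0 n] fps_nth_power_ternary[OF this, of 1 n]
  show "real (jacobi_count (2 * n)) = fact (3 * n) / (fact n * fact (2 * n + 1))"
    "real (jacobi_count (2 * n + 1)) = 2 * fact (3 * n + 1) / (fact n * fact (2 * n + 2))"
    using sq[of n] by (simp_all add: A_def power2_eq_square)
qed

text \<open>In the odd case \<open>(2n+2)! = 2(n+1)(2n+1)(2n)!\<close> cancels the factor 2 and
  turns \<open>n!\<close> into \<open>(n+1)!\<close>.\<close>

lemma jacobi_count_binomial:
  "real (jacobi_count (2 * n)) = 1 / real (2 * n + 1) * real ((3 * n) choose n)"
  "real (jacobi_count (2 * n + 1)) = 1 / real (2 * n + 1) * real ((3 * n + 1) choose (n + 1))"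
proof -
  have "real ((3 * n) choose n) = fact (3 * n) / (fact n * fact (2 * n))"
    using binomial_fact[of n "3 * n", where ?'a = real] by (simp add: mult_2)
  then show "real (jacobi_count (2 * n)) = 1 / real (2 * n + 1) * real ((3 * n) choose n)"
    unfolding jacobi_count_closed_forms by (simp add: divide_simps)
  have "real ((3 * n + 1) choose (n + 1)) = fact (3 * n + 1) / (fact (n + 1) * fact (2 * n))"
    using binomial_fact[of "n + 1" "3 * n + 1", where ?'a = real] by (simp add: mult_2)
  then show "real (jacobi_count (2 * n + 1)) = 1 / real (2 * n + 1) * real ((3 * n + 1) choose (n + 1))"
    unfolding jacobi_count_closed_forms by (simp add: divide_simps) (simp add: algebra_simps)
qed

theorem theorem4p1:
  fixes n :: nat
  shows "real (j_num (2 * n) {[2, 1, 3]}) = 1 / real (2 * n + 1) * real ((3 * n) choose n)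
    \<and> real (j_num (2 * n) {[3, 1, 2]}) = 1 / real (2 * n + 1) * real ((3 * n) choose n)
    \<and> real (j_num (2 * n + 1) {[2, 1, 3]}) = 1 / real (2 * n + 1) * real ((3 * n + 1) choose (n + 1))
    \<and> real (j_num (2 * n + 1) {[3, 1, 2]}) = 1 / real (2 * n + 1) * real ((3 * n + 1) choose (n + 1))"
  unfolding j_num_eq_jacobi_count jacobi_count_binomial by simp

end
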